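(* Let $(S,+,\circ)$ be a weak brace. Then the map $r:S\times S\to S\times S$ defined by $$r(a,b)=\left(a\circ(a^-+b),\ (a^-+b)^-\circ b\right)\qquad\text{for all } a,b\in S$$ is a set-theoretic solution of the Yang-Baxter equation on $S$.
   Context: A semigroup is inverse if each element $a$ has a unique inverse, i.e. a unique $x$ with $axa=a$ and $xax=x$. A weak (left) brace is a non-empty set $S$ with two binary operations $+$ and $\circ$ such that $(S,+)$ and $(S,\circ)$ are both inverse semigroups (not necessarily commutative) and, for all $a,b,c\in S$, $a\circ(b+c)=a\circ b-a+a\circ c$ and $a\circ a^-=-a+a$, where $-a$ is the inverse of $a$ in $(S,+)$, $a^-$ is the inverse of $a$ in $(S,\circ)$, and $\circ$ has higher precedence than $+$. A set-theoretic solution of the Yang-Baxter equation on a set $S$ is a map $r:S\times S\to S\times S$ with $(r\times \mathrm{id}_S)(\mathrm{id}_S\times r)(r\times \mathrm{id}_S)=(\mathrm{id}_S\times r)(r\times \mathrm{id}_S)(\mathrm{id}_S\times r)$ as maps on $S\times S\times S$. *)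

theory Defs
  imports Main "HOL-Library.FuncSet"
begin

definition is_sg_inverse :: "'a set \<Rightarrow> ('a \<Rightarrow> 'a \<Rightarrow> 'a) \<Rightarrow> 'a \<Rightarrow> 'a \<Rightarrow> bool"
  where "is_sg_inverse S f a x \<longleftrightarrow> x \<in> S \<and> f (f a x) a = a \<and> f (f x a) x = x"

text \<open>Meaningful for \<open>a \<in> S\<close> when \<open>(S, f)\<close> is an inverse semigroup, where the description is unique.\<close>

definition sg_inv :: "'a set \<Rightarrow> ('a \<Rightarrow> 'a \<Rightarrow> 'a) \<Rightarrow> 'a \<Rightarrow> 'a"
  where "sg_inv S f a = (THE x. is_sg_inverse S f a x)"

locale inverse_semigroup =
  fixes S :: "'a set" and f :: "'a \<Rightarrow> 'a \<Rightarrow> 'a"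
  assumes closed: "\<lbrakk>a \<in> S; b \<in> S\<rbrakk> \<Longrightarrow> f a b \<in> S"
    and assoc: "\<lbrakk>a \<in> S; b \<in> S; c \<in> S\<rbrakk> \<Longrightarrow> f (f a b) c = f a (f b c)"
    and unique_inverse: "a \<in> S \<Longrightarrow> \<exists>!x. is_sg_inverse S f a x"

locale weak_brace =
  add: inverse_semigroup S add + mul: inverse_semigroup S mul
  for S :: "'a set"
    and add :: "'a \<Rightarrow> 'a \<Rightarrow> 'a" (infixl "\<oplus>" 65)
    and mul :: "'a \<Rightarrow> 'a \<Rightarrow> 'a" (infixl "\<odot>" 70) +
  assumes nonempty: "S \<noteq> {}"
    and distrib: "\<lbrakk>a \<in> S; b \<in> S; c \<in> S\<rbrakk> \<Longrightarrow>
      a \<odot> (b \<oplus> c) = a \<odot> b \<oplus> sg_inv S (\<oplus>) a \<oplus> a \<odot> c"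
    and mul_inv: "a \<in> S \<Longrightarrow> a \<odot> sg_inv S (\<odot>) a = sg_inv S (\<oplus>) a \<oplus> a"

text \<open>\<open>r \<times> id\<close> and \<open>id \<times> r\<close> on triples; since \<open>'a \<times> 'a \<times> 'a\<close> is nested to the right,
  the former has to reassociate.\<close>

definition times_id :: "('a \<times> 'a \<Rightarrow> 'a \<times> 'a) \<Rightarrow> 'a \<times> 'a \<times> 'a \<Rightarrow> 'a \<times> 'a \<times> 'a"
  where "times_id r = (\<lambda>(x, y, z). case r (x, y) of (u, v) \<Rightarrow> (u, v, z))"

definition id_times :: "('a \<times> 'a \<Rightarrow> 'a \<times> 'a) \<Rightarrow> 'a \<times> 'a \<times> 'a \<Rightarrow> 'a \<times> 'a \<times> 'a"
  where "id_times r = map_prod id r"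

definition yang_baxter_solution :: "'a set \<Rightarrow> ('a \<times> 'a \<Rightarrow> 'a \<times> 'a) \<Rightarrow> bool"
  where "yang_baxter_solution S r \<longleftrightarrow>
    r \<in> S \<times> S \<rightarrow> S \<times> S \<and>
    (\<forall>t \<in> S \<times> S \<times> S.
      (times_id r \<circ> id_times r \<circ> times_id r) t = (id_times r \<circ> times_id r \<circ> id_times r) t)"

end

theory Submission
  imports Defs
begin

text \<open>
  In a skew brace, where both structures are groups, the map
  \<open>r (a, b) = (lam a b, rho b a)\<close> with \<open>lam a b = - a + a \<circ> b\<close> and
  \<open>rho b a = (lam a b)\<^sup>- \<circ> a \<circ> b\<close> solves the braid equation for three reasons:
  \<open>lam\<close> is a left action of \<open>(S, \<circ>)\<close> (\<open>lam_mul\<close>), \<open>rho\<close> is a right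
  action of \<open>(S, \<circ>)\<close> (\<open>rho_mul\<close>), and \<open>r\<close> preserves products
  (\<open>lam_mul_rho\<close>). The two actions match the outer components of the two sides of the equation.
  The products of all three components agree as well, so the middle components agree by
  cancellation.

  A weak brace has no cancellation; what is left of it is bookkeeping with idempotents. The key
  points are that the idempotents of the two semigroups are the same and multiply in the same way
  (\<open>idem_add_iff_idem_mul\<close>, \<open>idem_mul_eq_add\<close>), and that \<open>(S, +)\<close> is a Clifford
  semigroup, that is \<open>x - x = - x + x\<close> (\<open>add_clifford\<close>), so that its idempotents are
  central. To every \<open>a\<close> belongs the idempotent \<open>supp a = a \<circ> a\<^sup>- = a - a = - a + a\<close>,
  and a cancellation of \<open>a\<close> leaves \<open>supp a\<close> behind. Since
  \<open>supp (a \<circ> b) \<le> supp a\<close> (\<open>supp_mul_le\<close>), this remainder is absorbed by any neighbouring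
  product that starts with \<open>a\<close>, and the arguments for skew braces go through. The middle components
  need a little more (\<open>braid_middle\<close>): the idempotent that remains after cancelling the third component
  has to fix both candidates from the right, which \<open>supp_rho\<close> provides.
\<close>

section \<open>Inverse semigroups\<close>

context inverse_semigroup
begin

abbreviation inv :: "'a \<Rightarrow> 'a"
  where "inv \<equiv> sg_inv S f"

abbreviation idem :: "'a \<Rightarrow> bool"
  where "idem e \<equiv> e \<in> S \<and> f e e = e"

lemma sg_inv_is_inverse: "a \<in> S \<Longrightarrow> is_sg_inverse S f a (inv a)"
  unfolding sg_inv_def by (rule theI') (rule unique_inverse)

lemma inv_closed: "a \<in> S \<Longrightarrow> inv a \<in> S"
  and mult_inv_mult: "a \<in> S \<Longrightarrow> f a (f (inv a) a) = a"
  and inv_mult_inv: "a \<in> S \<Longrightarrow> f (inv a) (f a (inv a)) = inv a"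
  using sg_inv_is_inverse[of a] by (auto simp: is_sg_inverse_def assoc)

lemma inv_eqI:
  assumes "a \<in> S" "x \<in> S" "f a (f x a) = a" "f x (f a x) = x"
  shows "inv a = x"
proof -
  have "is_sg_inverse S f a x"
    using assms by (simp add: is_sg_inverse_def assoc)
  then show ?thesis
    unfolding sg_inv_def by (rule the1_equality[OF unique_inverse[OF assms(1)]])
qed

lemma inv_inv: "a \<in> S \<Longrightarrow> inv (inv a) = a"
  by (rule inv_eqI) (auto simp: inv_closed mult_inv_mult inv_mult_inv)

lemma inv_idem: "idem e \<Longrightarrow> inv e = e"
  by (rule inv_eqI) auto

lemma left_idem: "idem e \<Longrightarrow> x \<in> S \<Longrightarrow> f e (f e x) = f e x"
  by (metis assoc)

lemma idem_mult_inv: "a \<in> S \<Longrightarrow> idem (f a (inv a))"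
  by (simp add: closed inv_closed assoc inv_mult_inv)

lemma idem_inv_mult: "a \<in> S \<Longrightarrow> idem (f (inv a) a)"
  by (simp add: closed inv_closed assoc mult_inv_mult)

text \<open>
  The inverse \<open>x\<close> of \<open>e h\<close> equals \<open>h x e\<close>, because the latter is an inverse of \<open>e h\<close> too.
  This form makes \<open>x\<close> idempotent, hence its own inverse, so that \<open>e h = x\<close>.
\<close>

lemma idem_mult:
  assumes e: "idem e" and h: "idem h"
  shows "idem (f e h)"
proof -
  define x where "x = inv (f e h)"
  have S: "e \<in> S" "h \<in> S" "x \<in> S"
    using e h by (auto simp: x_def closed inv_closed)
  have ehx: "f e (f h (f x (f e h))) = f e h"
    using mult_inv_mult[of "f e h"] S by (simp add: x_def closed inv_closed assoc)
  have xeh: "f x (f e (f h x)) = x"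
    using inv_mult_inv[of "f e h"] S by (simp add: x_def closed inv_closed assoc)
  have "inv (f e h) = f h (f x e)"
  proof (rule inv_eqI)
    show "f (f e h) (f (f h (f x e)) (f e h)) = f e h"
      using S e h ehx by (simp add: closed assoc left_idem)
    have "f (f h (f x e)) (f (f e h) (f h (f x e))) = f h (f (f x (f e (f h x))) e)"
      using S e h by (simp add: closed assoc left_idem)
    then show "f (f h (f x e)) (f (f e h) (f h (f x e))) = f h (f x e)"
      by (simp add: xeh)
  qed (use S in \<open>auto simp: closed\<close>)
  then have x: "x = f h (f x e)"
    by (simp add: x_def)
  have "f x x = f (f h (f x e)) (f h (f x e))"
    using x by simp
  also have "\<dots> = f h (f (f x (f e (f h x))) e)"
    using S by (simp add: closed assoc)
  finally have "idem x"
    using x xeh S by simp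
  moreover have "f e h = inv x"
    using S by (simp add: x_def inv_inv closed)
  ultimately show ?thesis
    using inv_idem by metis
qed

text \<open>
  Both \<open>e h\<close> and \<open>h e\<close> are idempotent, which makes each of them an inverse of \<open>e h\<close>.
\<close>

lemma idem_commute:
  assumes e: "idem e" and h: "idem h"
  shows "f e h = f h e"
proof -
  have eh: "idem (f e h)" and he: "idem (f h e)"
    using assms idem_mult by auto
  have "inv (f e h) = f h e"
  proof (rule inv_eqI)
    show "f (f e h) (f (f h e) (f e h)) = f e h"
      using e h eh by (simp add: closed assoc left_idem)
    show "f (f h e) (f (f e h) (f h e)) = f h e"
      using e h he by (simp add: closed assoc left_idem)
  qed (use e h in \<open>auto simp: closed\<close>)
  then show ?thesis
    using inv_idem[OF eh] by simp
qed

lemma inv_mult: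
  assumes "a \<in> S" "b \<in> S"
  shows "inv (f a b) = f (inv b) (inv a)"
proof (rule inv_eqI)
  have S: "a \<in> S" "b \<in> S" "inv a \<in> S" "inv b \<in> S"
    using assms by (auto simp: inv_closed)
  have c: "f (f b (inv b)) (f (inv a) a) = f (f (inv a) a) (f b (inv b))"
    using assms by (intro idem_commute idem_mult_inv idem_inv_mult)
  have "f (f a b) (f (f (inv b) (inv a)) (f a b)) = f a (f (f (f b (inv b)) (f (inv a) a)) b)"
    using S by (simp add: closed assoc)
  also have "\<dots> = f (f a (f (inv a) a)) (f b (f (inv b) b))"
    unfolding c using S by (simp add: closed assoc)
  finally show "f (f a b) (f (f (inv b) (inv a)) (f a b)) = f a b"
    using S by (simp add: mult_inv_mult)
  have "f (f (inv b) (inv a)) (f (f a b) (f (inv b) (inv a)))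
      = f (inv b) (f (f (f (inv a) a) (f b (inv b))) (inv a))"
    using S by (simp add: closed assoc)
  also have "\<dots> = f (f (inv b) (f b (inv b))) (f (inv a) (f a (inv a)))"
    unfolding c[symmetric] using S by (simp add: closed assoc)
  finally show "f (f (inv b) (inv a)) (f (f a b) (f (inv b) (inv a))) = f (inv b) (inv a)"
    using S by (simp add: inv_mult_inv)
qed (use assms in \<open>auto simp: closed inv_closed\<close>)

lemma hom_inv:
  assumes "\<And>x. x \<in> S \<Longrightarrow> h x \<in> S"
    and "\<And>x y. x \<in> S \<Longrightarrow> y \<in> S \<Longrightarrow> h (f x y) = f (h x) (h y)"
    and "x \<in> S"
  shows "h (inv x) = inv (h x)"
  by (rule inv_eqI[symmetric])
    (use assms in \<open>auto simp: closed inv_closed mult_inv_mult inv_mult_inv simp flip: assms(2)\<close>)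

text \<open>
  Comparing the two idempotents of \<open>e x\<close>, which coincide, shows that conjugating \<open>e\<close> by
  \<open>x\<close> gives \<open>x\<^sup>- e x = e x x\<^sup>-\<close>. Multiplying by \<open>x\<close> from the left turns this into
  \<open>e x = x e\<close>.
\<close>

lemma idem_central_if_clifford:
  assumes clifford: "\<And>y. y \<in> S \<Longrightarrow> f y (inv y) = f (inv y) y"
    and e: "idem e" and x: "x \<in> S"
  shows "f e x = f x e"
proof -
  have S: "e \<in> S" "x \<in> S" "inv x \<in> S"
    using e x by (auto simp: inv_closed)
  have c: "f (f x (inv x)) e = f e (f x (inv x))"
    using e x by (intro idem_commute idem_mult_inv)
  have "f (f e x) (inv (f e x)) = f (inv (f e x)) (f e x)"
    using S by (intro clifford closed)
  then have "f e (f (f x (inv x)) e) = f (inv x) (f e x)"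
    using S e by (simp add: inv_mult inv_idem closed assoc left_idem)
  then have *: "f (inv x) (f e x) = f e (f x (inv x))"
    unfolding c using S e by (simp add: closed left_idem)
  have "f e x = f (f e (f x (inv x))) x"
    using S by (simp add: closed assoc mult_inv_mult)
  also have "\<dots> = f x (f (inv x) (f e x))"
    unfolding c[symmetric] using S by (simp add: closed assoc)
  also have "\<dots> = f x (f (f x (inv x)) e)"
    unfolding * c ..
  also have "\<dots> = f x e"
    unfolding clifford[OF x] using S by (simp add: closed mult_inv_mult flip: assoc) (simp add: closed mult_inv_mult assoc)
  finally show ?thesis .
qed

end

section \<open>Idempotents of a weak brace\<close>

context weak_brace
begin

abbreviation neg :: "'a \<Rightarrow> 'a" ("\<ominus> _" [81] 80)
  where "\<ominus> a \<equiv> sg_inv S (\<oplus>) a"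

abbreviation minv :: "'a \<Rightarrow> 'a" ("_\<^sup>-" [100] 100)
  where "a\<^sup>- \<equiv> sg_inv S (\<odot>) a"

text \<open>
  By \<open>add_clifford\<close> below, \<open>(S, +)\<close> is a union of groups, and \<open>supp a\<close> is the
  identity of the group that contains \<open>a\<close>. In \<open>(S, \<circ>)\<close> it is only a left identity of
  \<open>a\<close>; the right one, \<open>a\<^sup>- \<circ> a\<close>, may differ.
\<close>

definition supp :: "'a \<Rightarrow> 'a"
  where "supp a = a \<odot> a\<^sup>-"

lemmas closure = add.closed mul.closed add.inv_closed mul.inv_closed

lemma supp_eq: "a \<in> S \<Longrightarrow> supp a = \<ominus> a \<oplus> a"
  by (simp add: supp_def mul_inv)

text \<open>
  An idempotent of either semigroup is its own inverse there, so the axiom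
  \<open>a \<circ> a\<^sup>- = - a + a\<close> expresses it as an idempotent of the other one.
\<close>

lemma idem_add_iff_idem_mul: "add.idem e \<longleftrightarrow> mul.idem e"
  by (metis add.idem_inv_mult add.inv_idem mul.idem_mult_inv mul.inv_idem mul_inv)

lemma idem_supp: "a \<in> S \<Longrightarrow> add.idem (supp a)"
  by (simp add: supp_eq add.idem_inv_mult)

lemma supp_closed: "a \<in> S \<Longrightarrow> supp a \<in> S"
  by (simp add: idem_supp)

text \<open>
  Distributing \<open>e\<close> over \<open>h + h\<close> inserts a summand \<open>e\<close> into \<open>e \<circ> h\<close>. So the
  multiplicative meet of two idempotents lies below each of them in the order of \<open>(S, +)\<close>.
\<close>

lemma idem_mul_add_left:
  assumes e: "add.idem e" and h: "add.idem h"
  shows "e \<odot> h \<oplus> e = e \<odot> h"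
proof -
  have eh: "add.idem (e \<odot> h)"
    using e h idem_add_iff_idem_mul mul.idem_mult by metis
  have "e \<odot> h = e \<odot> h \<oplus> e \<oplus> e \<odot> h"
    using distrib[of e h h] e h by (simp add: add.inv_idem)
  also have "\<dots> = e \<odot> h \<oplus> (e \<odot> h \<oplus> e)"
    using add.idem_commute[OF e eh] e eh by (simp add: add.assoc)
  also have "\<dots> = e \<odot> h \<oplus> e"
    using e eh by (simp add: add.left_idem)
  finally show ?thesis ..
qed

text \<open>
  Write \<open>g = e + h\<close>. Distributing gives \<open>e \<circ> g = e + e \<circ> h = e \<circ> h\<close>. It remains to see
  that \<open>e \<circ> g = g\<close>. This does not come from distributing \<open>e\<close>, but from distributing
  \<open>g\<close> over \<open>g + e\<close>, which is \<open>g\<close> again.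
\<close>

lemma idem_mul_eq_add:
  assumes e: "add.idem e" and h: "add.idem h"
  shows "e \<odot> h = e \<oplus> h"
proof -
  have S: "e \<in> S" "h \<in> S" and eh: "add.idem (e \<odot> h)" and g: "add.idem (e \<oplus> h)"
    using e h idem_add_iff_idem_mul mul.idem_mult add.idem_mult by metis+
  let ?g = "e \<oplus> h"
  have ee: "e \<odot> e = e" and gg: "?g \<odot> ?g = ?g"
    using e g idem_add_iff_idem_mul by metis+
  have "e \<odot> ?g = e \<oplus> e \<oplus> e \<odot> h"
    using S ee add.inv_idem[OF e] by (simp add: distrib)
  also have "\<dots> = e \<odot> h"
    using idem_mul_add_left[OF e h] add.idem_commute[OF e eh] e by simp
  finally have 1: "e \<odot> ?g = e \<odot> h" .
  have "?g = ?g \<odot> (?g \<oplus> e)"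
    using add.idem_commute[OF g e] e S gg by (simp add: add.left_idem)
  also have "\<dots> = ?g \<oplus> ?g \<oplus> ?g \<odot> e"
    using distrib[of ?g ?g e] g S gg add.inv_idem[OF g] by simp
  also have "\<dots> = ?g \<odot> e"
    using idem_mul_add_left[OF g e] add.idem_commute[OF g, of "?g \<odot> e"] g e
      idem_add_iff_idem_mul mul.idem_mult by metis
  also have "\<dots> = e \<odot> ?g"
    using g e idem_add_iff_idem_mul mul.idem_commute by metis
  finally show ?thesis
    using 1 by simp
qed

lemma supp_mul_self: "a \<in> S \<Longrightarrow> supp a \<odot> a = a"
  by (simp add: supp_def closure mul.assoc mul.mult_inv_mult)

text \<open>
  One half of the Clifford property: \<open>x - x \<le> - x + x\<close> in the order of idempotents. The element
  \<open>e = supp x\<close> fixes \<open>x\<close> multiplicatively, and \<open>h = x - x\<close> fixes it additively.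
  Distributing \<open>e\<close> over \<open>h + x\<close> therefore yields \<open>x = e + x\<close>, and a summand
  \<open>- x\<close> on the right turns this into \<open>h = e + h\<close>.
\<close>

lemma add_neg_le_supp:
  assumes "x \<in> S"
  shows "x \<oplus> \<ominus> x \<oplus> supp x = x \<oplus> \<ominus> x"
proof -
  let ?e = "supp x" and ?h = "x \<oplus> \<ominus> x"
  have e: "add.idem ?e" and h: "add.idem ?h" and S: "?e \<in> S" "?h \<in> S" "\<ominus> x \<in> S"
    using assms idem_supp add.idem_mult_inv closure by auto
  have hx: "?h \<oplus> x = x"
    using assms S by (simp add: add.assoc add.mult_inv_mult)
  have "x = ?e \<odot> (?h \<oplus> x)"
    unfolding hx using assms by (simp add: supp_mul_self)
  also have "\<dots> = ?e \<odot> ?h \<oplus> ?e \<oplus> x"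
    using assms S e by (simp add: distrib add.inv_idem supp_mul_self)
  also have "\<dots> = ?e \<oplus> ?h \<oplus> x"
    using idem_mul_add_left[OF e h] idem_mul_eq_add[OF e h] by simp
  also have "\<dots> = ?e \<oplus> x"
    using assms S hx by (simp add: add.assoc)
  finally have "?e \<oplus> ?h = ?h"
    using assms S by (metis add.assoc)
  then show ?thesis
    using add.idem_commute[OF e h] by simp
qed

text \<open>
  The preceding inequality for \<open>x\<close> and for \<open>- x\<close> gives both directions.
\<close>

lemma add_clifford:
  assumes "x \<in> S"
  shows "x \<oplus> \<ominus> x = \<ominus> x \<oplus> x"
proof -
  have S: "\<ominus> x \<in> S"
    using assms by (simp add: closure)
  have "x \<oplus> \<ominus> x \<oplus> (\<ominus> x \<oplus> x) = x \<oplus> \<ominus> x"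
    using add_neg_le_supp[OF assms] assms by (simp add: supp_eq)
  moreover have "\<ominus> x \<oplus> x \<oplus> (x \<oplus> \<ominus> x) = \<ominus> x \<oplus> x"
    using add_neg_le_supp[OF S] assms S by (simp add: supp_eq add.inv_inv)
  ultimately show ?thesis
    using add.idem_commute[OF add.idem_mult_inv add.idem_inv_mult, OF assms assms] by simp
qed

lemma supp_eq': "a \<in> S \<Longrightarrow> a \<oplus> \<ominus> a = supp a"
  by (simp add: supp_eq add_clifford)

lemma supp_central: "a \<in> S \<Longrightarrow> x \<in> S \<Longrightarrow> supp a \<oplus> x = x \<oplus> supp a"
  by (rule add.idem_central_if_clifford) (auto simp: add_clifford idem_supp supp_closed)

lemma supp_add_self: "a \<in> S \<Longrightarrow> supp a \<oplus> a = a"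
  by (simp add: supp_eq' [symmetric] closure add.assoc add.mult_inv_mult)

lemma supp_neg: "a \<in> S \<Longrightarrow> supp (\<ominus> a) = supp a"
  using supp_eq'[of a] supp_eq[of "\<ominus> a"] by (simp add: closure add.inv_inv)

lemma supp_add:
  assumes "a \<in> S" "b \<in> S"
  shows "supp (a \<oplus> b) = supp a \<oplus> supp b"
proof -
  have S: "\<ominus> a \<in> S" "\<ominus> b \<in> S" "supp a \<in> S" "supp b \<in> S"
    using assms by (auto simp: closure supp_closed)
  have "supp (a \<oplus> b) = \<ominus> b \<oplus> (\<ominus> a \<oplus> a) \<oplus> b"
    using assms S by (simp add: supp_eq closure add.inv_mult add.assoc)
  also have "\<dots> = supp a \<oplus> \<ominus> b \<oplus> b"
    using assms S by (simp add: supp_central flip: supp_eq)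
  also have "\<dots> = supp a \<oplus> (\<ominus> b \<oplus> b)"
    using assms S by (simp add: add.assoc)
  finally show ?thesis
    using assms by (simp add: supp_eq)
qed

lemma supp_mul:
  assumes "a \<in> S" "b \<in> S"
  shows "supp (a \<odot> b) = a \<odot> (supp b \<odot> a\<^sup>-)"
  using assms by (simp add: supp_def closure mul.inv_mult mul.assoc)

text \<open>
  As \<open>supp (a \<circ> b)\<close> is a product that starts with \<open>a\<close>, it is fixed by
  \<open>supp a\<close> multiplicatively, and for idempotents the two operations agree.
\<close>

lemma supp_mul_le:
  assumes "a \<in> S" "b \<in> S"
  shows "supp a \<oplus> supp (a \<odot> b) = supp (a \<odot> b)"
proof -
  have S: "supp a \<in> S" "supp b \<in> S" "a\<^sup>- \<in> S"
    using assms by (auto simp: closure supp_closed)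
  have "supp a \<oplus> supp (a \<odot> b) = supp a \<odot> supp (a \<odot> b)"
    using assms by (simp add: idem_mul_eq_add idem_supp closure)
  also have "\<dots> = supp a \<odot> a \<odot> (supp b \<odot> a\<^sup>-)"
    using assms S by (simp add: supp_mul closure mul.assoc)
  finally show ?thesis
    using assms by (simp add: supp_mul supp_mul_self)
qed

text \<open>
  Additive information on supports becomes a multiplicative absorption law.
\<close>

lemma mul_absorbs_if_supp_le:
  assumes "e \<in> S" "x \<in> S" "supp e \<oplus> supp x = supp x"
  shows "supp e \<odot> x = x"
proof -
  have "supp e \<odot> x = supp e \<odot> supp x \<odot> x"
    using assms by (simp add: mul.assoc supp_closed supp_mul_self)
  also have "\<dots> = x"
    using assms by (simp add: idem_mul_eq_add idem_supp supp_mul_self)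
  finally show ?thesis .
qed

text \<open>
  This is what makes up for the missing cancellation: the idempotent left by \<open>a - a\<close>
  disappears in front of a product that starts with \<open>a\<close>.
\<close>

lemma supp_add_mul:
  assumes "a \<in> S" "b \<in> S"
  shows "supp a \<oplus> a \<odot> b = a \<odot> b"
proof -
  have S: "a \<odot> b \<in> S"
    using assms by (simp add: closure)
  then have "supp a \<oplus> a \<odot> b = supp a \<oplus> (supp (a \<odot> b) \<oplus> a \<odot> b)"
    by (simp add: supp_add_self)
  also have "\<dots> = supp (a \<odot> b) \<oplus> a \<odot> b"
    using assms S by (simp add: supp_closed supp_mul_le flip: add.assoc)
  finally show ?thesis
    using S by (simp add: supp_add_self)
qed

section \<open>The two actions\<close>

definition lam :: "'a \<Rightarrow> 'a \<Rightarrow> 'a"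
  where "lam a b = \<ominus> a \<oplus> a \<odot> b"

text \<open>
  The subscript comes first, so that \<open>rho b\<close> is the map usually written \<open>\<rho>\<^sub>b\<close>. This form
  exhibits the second component of \<open>r (a, b)\<close> as the quotient of \<open>a \<circ> b\<close> by the first one; it
  agrees with the usual one by \<open>inv_add_inv_mul_eq_rho\<close>.
\<close>

definition rho :: "'a \<Rightarrow> 'a \<Rightarrow> 'a"
  where "rho b a = (lam a b)\<^sup>- \<odot> (a \<odot> b)"

lemma lam_closed: "a \<in> S \<Longrightarrow> b \<in> S \<Longrightarrow> lam a b \<in> S"
  by (simp add: lam_def closure)

lemma rho_closed: "a \<in> S \<Longrightarrow> b \<in> S \<Longrightarrow> rho b a \<in> S"
  by (simp add: rho_def closure lam_closed)

lemma mul_inv_add_eq_lam: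
  assumes "a \<in> S" "b \<in> S"
  shows "a \<odot> (a\<^sup>- \<oplus> b) = lam a b"
proof -
  have "a \<odot> (a\<^sup>- \<oplus> b) = supp a \<oplus> \<ominus> a \<oplus> a \<odot> b"
    using assms by (simp add: distrib closure supp_def)
  then show ?thesis
    using assms supp_add_self[of "\<ominus> a"] by (simp add: lam_def supp_neg closure)
qed

text \<open>
  Expanding \<open>rho b a\<close> with \<open>lam a b = a \<circ> x\<close> for \<open>x = a\<^sup>- + b\<close> leaves the
  idempotent \<open>a\<^sup>- \<circ> a = supp (a\<^sup>-)\<close> between \<open>x\<^sup>-\<close> and \<open>b\<close>. It is absorbed by
  \<open>x\<^sup>-\<close>, because \<open>supp x\<close> is below it.
\<close>

lemma inv_add_inv_mul_eq_rho:
  assumes "a \<in> S" "b \<in> S"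
  shows "(a\<^sup>- \<oplus> b)\<^sup>- \<odot> b = rho b a"
proof -
  let ?x = "a\<^sup>- \<oplus> b"
  have S: "a\<^sup>- \<in> S" "?x \<in> S" "?x\<^sup>- \<in> S" "supp (a\<^sup>-) \<in> S"
    using assms by (auto simp: closure supp_closed)
  have "supp (a\<^sup>-) \<oplus> supp ?x = supp ?x"
    using assms S by (simp add: supp_add add.left_idem idem_supp supp_closed)
  then have "supp (a\<^sup>-) \<odot> ?x = ?x"
    using S by (simp add: mul_absorbs_if_supp_le)
  then have "?x\<^sup>- = ?x\<^sup>- \<odot> supp (a\<^sup>-)"
    using S idem_supp idem_add_iff_idem_mul mul.inv_mult mul.inv_idem by metis
  then have "?x\<^sup>- \<odot> b = ?x\<^sup>- \<odot> (a\<^sup>- \<odot> a) \<odot> b"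
    using assms by (simp add: supp_def mul.inv_inv)
  also have "\<dots> = (a \<odot> ?x)\<^sup>- \<odot> (a \<odot> b)"
    using assms S by (simp add: mul.inv_mult mul.assoc closure)
  finally show ?thesis
    using assms by (simp add: rho_def mul_inv_add_eq_lam)
qed

lemma lam_add:
  assumes "a \<in> S" "b \<in> S" "c \<in> S"
  shows "lam a (b \<oplus> c) = lam a b \<oplus> lam a c"
  using assms by (simp add: lam_def distrib closure add.assoc)

lemma lam_neg: "a \<in> S \<Longrightarrow> b \<in> S \<Longrightarrow> lam a (\<ominus> b) = \<ominus> lam a b"
  by (rule add.hom_inv) (auto simp: lam_closed lam_add)

lemma add_lam: "a \<in> S \<Longrightarrow> b \<in> S \<Longrightarrow> a \<oplus> lam a b = a \<odot> b"
  using supp_add_mul[of a b] by (simp add: lam_def closure supp_eq' flip: add.assoc)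

lemma supp_lam:
  assumes "a \<in> S" "b \<in> S"
  shows "supp (lam a b) = supp (a \<odot> b)"
  using assms by (simp add: lam_def supp_add supp_neg supp_mul_le closure)

text \<open>
  Since \<open>lam a\<close> is an endomorphism of \<open>(S, +)\<close>, it maps \<open>- b + b \<circ> c\<close> to
  \<open>- a \<circ> b + a - a + a \<circ> b \<circ> c\<close>, where \<open>a - a\<close> is absorbed.
\<close>

lemma lam_mul:
  assumes "a \<in> S" "b \<in> S" "c \<in> S"
  shows "lam a (lam b c) = lam (a \<odot> b) c"
proof -
  have S: "\<ominus> a \<in> S" "\<ominus> b \<in> S" "a \<odot> b \<in> S" "\<ominus> (a \<odot> b) \<in> S" "b \<odot> c \<in> S" "a \<odot> (b \<odot> c) \<in> S"
    using assms by (auto simp: closure)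
  have "lam a (lam b c) = \<ominus> lam a b \<oplus> lam a (b \<odot> c)"
    using assms S by (simp add: lam_def[of b] lam_add lam_neg)
  also have "\<dots> = \<ominus> (a \<odot> b) \<oplus> (supp a \<oplus> a \<odot> (b \<odot> c))"
    using assms S by (simp add: lam_def add.inv_mult add.inv_inv supp_eq'[symmetric] closure add.assoc)
  also have "\<dots> = lam (a \<odot> b) c"
    using assms S by (simp add: lam_def supp_add_mul mul.assoc)
  finally show ?thesis .
qed

text \<open>
  Here the idempotent left by the first component is the support of \<open>a \<circ> b\<close> itself.
\<close>

lemma lam_mul_rho:
  assumes "a \<in> S" "b \<in> S"
  shows "lam a b \<odot> rho b a = a \<odot> b"
proof -
  have "lam a b \<odot> rho b a = supp (lam a b) \<odot> (a \<odot> b)"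
    using assms by (simp add: rho_def supp_def mul.assoc closure lam_closed)
  then show ?thesis
    using assms by (simp add: supp_lam supp_mul_self closure)
qed

text \<open>
  The support of the second component is the right identity of the first one in
  \<open>(S, \<circ>)\<close>, so the second component can be cancelled after the first one without loss.
\<close>

lemma supp_rho:
  assumes "a \<in> S" "b \<in> S"
  shows "supp (rho b a) = (lam a b)\<^sup>- \<odot> lam a b"
proof -
  let ?l = "lam a b"
  have S: "?l \<in> S" "?l\<^sup>- \<in> S" "a \<odot> b \<in> S"
    using assms by (auto simp: lam_closed closure)
  have "supp (rho b a) = ?l\<^sup>- \<odot> (supp ?l \<odot> ?l)"
    using assms S by (simp add: rho_def supp_mul[of "?l\<^sup>-"] mul.inv_inv supp_lam)
  then show ?thesis
    using S by (simp add: supp_mul_self)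
qed

text \<open>
  With \<open>u = lam a b\<close> and \<open>v = rho b a\<close>, the equation \<open>u \<circ> v = a \<circ> b\<close> reduces
  \<open>u \<circ> (- v + v \<circ> c)\<close> to a sum of elements \<open>\<plusminus> u\<close>, \<open>\<plusminus> a \<circ> b\<close> and
  \<open>a \<circ> b \<circ> c\<close>. In it \<open>u\<close> and \<open>a \<circ> b\<close> cancel up to their common support, which
  \<open>a \<circ> b \<circ> c\<close> absorbs. Only \<open>- a\<close> from \<open>u = - a + a \<circ> b\<close> survives.
\<close>

lemma lam_mul_right:
  assumes "a \<in> S" "b \<in> S" "c \<in> S"
  shows "lam a (b \<odot> c) = lam a b \<odot> lam (rho b a) c"
proof -
  let ?u = "lam a b" and ?v = "rho b a" and ?ab = "a \<odot> b"
  have S: "?u \<in> S" "?v \<in> S" "?ab \<in> S" "\<ominus> ?u \<in> S" "\<ominus> ?v \<in> S" "\<ominus> ?ab \<in> S" "?v \<odot> c \<in> S"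
    "?ab \<odot> c \<in> S" "\<ominus> a \<in> S" "supp ?ab \<in> S"
    using assms by (auto simp: lam_closed rho_closed closure supp_closed)
  have uv: "?u \<odot> ?v = ?ab"
    using assms by (simp add: lam_mul_rho)
  have uvc: "?u \<odot> (?v \<odot> c) = ?ab \<odot> c"
    using assms S by (simp add: uv flip: mul.assoc)
  have "?u \<odot> \<ominus> ?v = ?u \<oplus> \<ominus> lam ?u ?v"
    using S by (simp add: lam_neg flip: add_lam)
  also have "\<dots> = ?u \<oplus> (\<ominus> ?ab \<oplus> ?u)"
    using S by (simp add: lam_def[of ?u] uv add.inv_mult add.inv_inv)
  finally have uneg: "?u \<odot> \<ominus> ?v = ?u \<oplus> (\<ominus> ?ab \<oplus> ?u)" .
  have "?u \<odot> lam ?v c = ?u \<odot> \<ominus> ?v \<oplus> \<ominus> ?u \<oplus> ?ab \<odot> c"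
    using assms S by (simp add: lam_def[of ?v] distrib uvc)
  also have "\<dots> = ?u \<oplus> (\<ominus> ?ab \<oplus> (supp ?u \<oplus> ?ab \<odot> c))"
    using S by (simp add: uneg supp_eq'[symmetric] closure add.assoc)
  also have "supp ?u \<oplus> ?ab \<odot> c = ?ab \<odot> c"
    using assms S by (simp add: supp_lam supp_add_mul)
  also have "?u \<oplus> (\<ominus> ?ab \<oplus> ?ab \<odot> c) = \<ominus> a \<oplus> (supp ?ab \<oplus> ?ab \<odot> c)"
    using S by (simp add: lam_def[of a] supp_eq'[symmetric] closure add.assoc)
  also have "\<dots> = \<ominus> a \<oplus> ?ab \<odot> c"
    using assms S by (simp add: supp_add_mul)
  finally show ?thesis
    using assms by (simp add: lam_def[of a] mul.assoc)
qed

text \<open>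
  Both sides are a quotient of \<open>a \<circ> b \<circ> c\<close>, and by \<open>lam_mul_right\<close> the two
  divisors coincide.
\<close>

lemma rho_mul:
  assumes "a \<in> S" "b \<in> S" "c \<in> S"
  shows "rho c (rho b a) = rho (b \<odot> c) a"
proof -
  let ?u = "lam a b" and ?v = "rho b a"
  have S: "?u \<in> S" "?v \<in> S" "?u\<^sup>- \<in> S" "lam ?v c \<in> S" "(lam ?v c)\<^sup>- \<in> S"
    using assms by (auto simp: lam_closed rho_closed closure)
  have "rho c ?v = (lam ?v c)\<^sup>- \<odot> (?u\<^sup>- \<odot> (a \<odot> b) \<odot> c)"
    by (simp add: rho_def)
  also have "\<dots> = (?u \<odot> lam ?v c)\<^sup>- \<odot> (a \<odot> (b \<odot> c))"
    using assms S by (simp add: mul.inv_mult mul.assoc closure)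
  finally show ?thesis
    using assms by (simp add: rho_def[of "b \<odot> c"] lam_mul_right)
qed

text \<open>
  The two middle components \<open>Y\<^sub>1\<close> and \<open>Y\<^sub>2\<close> sit between the same first component \<open>X\<close> and
  the same third component \<open>Z\<close>. Both \<open>Y\<^sub>i \<circ> Z\<close> equal \<open>X\<^sup>- \<circ> a \<circ> b \<circ> c\<close>.
  By \<open>supp_rho\<close>, the idempotent \<open>Z \<circ> Z\<^sup>-\<close> fixes both \<open>Y\<^sub>i\<close> from the right: for
  \<open>Y\<^sub>2\<close>, as \<open>(Y\<^sub>2, Z)\<close> is a value of \<open>r\<close>; for \<open>Y\<^sub>1\<close>, as it is a product that ends
  with \<open>lam (rho b a) c\<close>, the partner of \<open>Z\<close>. So \<open>Z\<close> can be cancelled.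
\<close>

lemma braid_middle:
  assumes "a \<in> S" "b \<in> S" "c \<in> S"
  shows "rho (lam (rho b a) c) (lam a b) = lam (rho (lam b c) a) (rho c b)"
    (is "?Y\<^sub>1 = ?Y\<^sub>2")
proof -
  let ?u = "lam a b" and ?v = "rho b a" and ?p = "rho (lam b c) a" and ?q = "rho c b"
  let ?l = "lam ?v c" and ?X = "lam (a \<odot> b) c" and ?Z = "rho c ?v"
  have S: "?u \<in> S" "?v \<in> S" "?p \<in> S" "?q \<in> S" "?l \<in> S" "?X \<in> S" "?Z \<in> S" "lam b c \<in> S"
    "?Y\<^sub>1 \<in> S" "?Y\<^sub>2 \<in> S" "?X\<^sup>- \<in> S" "?l\<^sup>- \<in> S" "?Z\<^sup>- \<in> S"
    using assms by (auto simp: lam_closed rho_closed closure)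
  have Y\<^sub>1: "?Y\<^sub>1 = ?X\<^sup>- \<odot> (?u \<odot> ?l)"
    using assms S by (simp add: rho_def[of ?l] lam_mul lam_mul_rho)
  have p: "?p = ?X\<^sup>- \<odot> (a \<odot> lam b c)"
    using assms S by (simp add: rho_def[of "lam b c"] lam_mul)
  have Z: "?Z = rho ?q ?p"
    using assms S by (simp add: rho_mul lam_mul_rho)
  have "?Y\<^sub>1 \<odot> ?Z = ?X\<^sup>- \<odot> (?u \<odot> (?l \<odot> ?Z))"
    using S by (simp add: Y\<^sub>1 mul.assoc closure)
  also have "\<dots> = ?X\<^sup>- \<odot> (?u \<odot> (?v \<odot> c))"
    using assms S by (simp add: lam_mul_rho)
  also have "\<dots> = ?X\<^sup>- \<odot> (?u \<odot> ?v \<odot> c)"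
    using assms S by (simp add: mul.assoc)
  also have "\<dots> = ?X\<^sup>- \<odot> (a \<odot> b \<odot> c)"
    using assms by (simp add: lam_mul_rho)
  also have "\<dots> = ?X\<^sup>- \<odot> (a \<odot> (lam b c \<odot> ?q))"
    using assms by (simp add: lam_mul_rho mul.assoc)
  also have "\<dots> = ?p \<odot> ?q"
    using assms S by (simp add: p mul.assoc closure)
  also have "\<dots> = ?Y\<^sub>2 \<odot> ?Z"
    using S by (simp add: Z lam_mul_rho)
  finally have eq: "?Y\<^sub>1 \<odot> ?Z = ?Y\<^sub>2 \<odot> ?Z" .
  have "?Y\<^sub>1 = ?Y\<^sub>1 \<odot> supp ?Z"
    using assms S by (simp add: supp_rho Y\<^sub>1 mul.assoc closure mul.mult_inv_mult)
  also have "\<dots> = ?Y\<^sub>1 \<odot> ?Z \<odot> ?Z\<^sup>-"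
    using S by (simp add: supp_def mul.assoc)
  also have "\<dots> = ?Y\<^sub>2 \<odot> supp ?Z"
    using S by (simp add: eq supp_def mul.assoc)
  also have "\<dots> = ?Y\<^sub>2"
    using S unfolding Z by (simp add: supp_rho mul.mult_inv_mult)
  finally show ?thesis .
qed

end

section \<open>The solution\<close>

theorem theorem14:
  fixes S :: "'a set"
    and add :: "'a \<Rightarrow> 'a \<Rightarrow> 'a" (infixl "\<oplus>" 65)
    and mul :: "'a \<Rightarrow> 'a \<Rightarrow> 'a" (infixl "\<odot>" 70)
    and r :: "'a \<times> 'a \<Rightarrow> 'a \<times> 'a"
  assumes "weak_brace S (\<oplus>) (\<odot>)"
    and "\<And>a b. \<lbrakk>a \<in> S; b \<in> S\<rbrakk> \<Longrightarrow>
      r (a, b) = (a \<odot> (sg_inv S (\<odot>) a \<oplus> b), sg_inv S (\<odot>) (sg_inv S (\<odot>) a \<oplus> b) \<odot> b)"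
  shows "yang_baxter_solution S r"
proof -
  interpret weak_brace S "(\<oplus>)" "(\<odot>)"
    by (rule assms(1))
  have r: "r (a, b) = (lam a b, rho b a)" if "a \<in> S" "b \<in> S" for a b
    using that by (simp add: assms(2) mul_inv_add_eq_lam inv_add_inv_mul_eq_rho)
  show ?thesis
    unfolding yang_baxter_solution_def
  proof (intro conjI ballI)
    show "r \<in> S \<times> S \<rightarrow> S \<times> S"
      by (auto simp: r lam_closed rho_closed)
  next
    fix t
    assume "t \<in> S \<times> S \<times> S"
    then obtain a b c where t: "t = (a, b, c)" and S: "a \<in> S" "b \<in> S" "c \<in> S"
      by auto
    have "(times_id r \<circ> id_times r \<circ> times_id r) t
        = (lam (lam a b) (lam (rho b a) c), rho (lam (rho b a) c) (lam a b), rho c (rho b a))"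
      using S by (simp add: t times_id_def id_times_def r lam_closed rho_closed)
    moreover have "(id_times r \<circ> times_id r \<circ> id_times r) t
        = (lam a (lam b c), lam (rho (lam b c) a) (rho c b), rho (rho c b) (rho (lam b c) a))"
      using S by (simp add: t times_id_def id_times_def r lam_closed rho_closed)
    ultimately show "(times_id r \<circ> id_times r \<circ> times_id r) t = (id_times r \<circ> times_id r \<circ> id_times r) t"
      using S by (simp add: lam_mul rho_mul lam_mul_rho braid_middle lam_closed rho_closed)
  qed
qed

end
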